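(* Let $(L,\leqslant)$ be a poset. Then $L$ is an L-domain if and only if there exists an L-approximation space $(U,R,\mathcal F)$ such that $(L,\leqslant)$ is order-isomorphic to $(\mathfrak C(U,R,\mathcal F),\subseteq)$.
   Context: Upper approximation: for a set $U$, a binary relation $R$ on $U$ and $A\subseteq U$, put $\overline R(A)=\{x\in U\mid \exists y\in A,\ xRy\}$. $K\subseteq_{fin}X$ means that $K$ is a finite (possibly empty) subset of $X$, and $\mathcal P_{fin}(U)$ is the set of all finite subsets of $U$. CF-approximation space: a triple $(U,R,\mathcal F)$ with $R$ a transitive relation on the set $U$ and $\emptyset\neq\mathcal F\subseteq\mathcal P_{fin}(U)$ such that for every $F\in\mathcal F$ and every $K\subseteq_{fin}\overline R(F)$ there is $G\in\mathcal F$ with $K\subseteq\overline R(G)$ and $G\subseteq\overline R(F)$. CF-closed set: $E\subseteq U$ such that for every $K\subseteq_{fin}E$ there is $F\in\mathcal F$ with $K\subseteq\overline R(F)\subseteq E$ and $F\subseteq E$. $\mathfrak C(U,R,\mathcal F)$ is the set of all CF-closed sets. Join saturation: $\mathcal F^{\sharp}$ is the set of all unions $\bigcup\mathcal A$ of nonempty finite subfamilies $\mathcal A\subseteq\mathcal F$. L-approximation space: a CF-approximation space $(U,R,\mathcal F)$ such that for all $M\in\mathcal F^{\sharp}\cup\{\emptyset\}$ and $F\in\mathcal F$ with $M\subseteq\overline R(F)$ there is $G\in\mathcal F$ satisfying: (sL-1) $\overline R(M)\subseteq\overline R(G)\subseteq\overline R(F)$; and (sL-2) for all $G'\in\mathcal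 F$, $\overline R(M)\subseteq\overline R(G')\subseteq\overline R(F)$ implies $\overline R(G)\subseteq\overline R(G')$. Domains: directed sets are nonempty; a dcpo is a poset in which every directed subset has a supremum. $x\ll y$ means that for every directed $D$ having a supremum with $\sup D\geqslant y$ there is $d\in D$ with $x\leqslant d$. A continuous domain is a dcpo in which, for every $x$, the set $\{y\mid y\ll x\}$ is directed with supremum $x$. An L-domain is a continuous domain $L$ such that for every $x\in L$ the principal ideal ${\downarrow}x=\{y\in L\mid y\leqslant x\}$, with the inherited order, is a complete lattice (L-domains need not have a least element).
   Formalization: The poset L is assumed nonempty: the empty poset is vacuously an L-domain, but the set of CF-closed sets of an L-approximation space is never empty, so the equivalence fails for it. *)

theory Defs
  imports "HOL-Algebra.Complete_Lattice"
begin

section \<open>L-domains\<close>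

definition directed_in :: "('a, 'b) gorder_scheme \<Rightarrow> 'a set \<Rightarrow> bool" where
  "directed_in L D \<longleftrightarrow>
     D \<subseteq> carrier L \<and> D \<noteq> {} \<and> (\<forall>x\<in>D. \<forall>y\<in>D. \<exists>z\<in>D. x \<sqsubseteq>\<^bsub>L\<^esub> z \<and> y \<sqsubseteq>\<^bsub>L\<^esub> z)"

definition dcpo :: "('a, 'b) gorder_scheme \<Rightarrow> bool" where
  "dcpo L \<longleftrightarrow> partial_order L \<and> (\<forall>D. directed_in L D \<longrightarrow> (\<exists>s. is_lub L s D))"

definition way_below :: "('a, 'b) gorder_scheme \<Rightarrow> 'a \<Rightarrow> 'a \<Rightarrow> bool" where
  "way_below L x y \<longleftrightarrow>
     (\<forall>D s. directed_in L D \<and> is_lub L s D \<and> y \<sqsubseteq>\<^bsub>L\<^esub> s \<longrightarrow> (\<exists>d\<in>D. x \<sqsubseteq>\<^bsub>L\<^esub> d))"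

definition continuous_domain :: "('a, 'b) gorder_scheme \<Rightarrow> bool" where
  "continuous_domain L \<longleftrightarrow>
     dcpo L \<and>
     (\<forall>x\<in>carrier L.
        directed_in L {y \<in> carrier L. way_below L y x} \<and>
        is_lub L x {y \<in> carrier L. way_below L y x})"

definition L_domain :: "('a, 'b) gorder_scheme \<Rightarrow> bool" where
  "L_domain L \<longleftrightarrow>
     continuous_domain L \<and>
     (\<forall>x\<in>carrier L. complete_lattice (L\<lparr>carrier := {y \<in> carrier L. y \<sqsubseteq>\<^bsub>L\<^esub> x}\<rparr>))"

definition order_isomorphic ::
  "('a, 'b) gorder_scheme \<Rightarrow> ('c, 'd) gorder_scheme \<Rightarrow> bool" where
  "order_isomorphic L M \<longleftrightarrow>
     (\<exists>f. bij_betw f (carrier L) (carrier M) \<and> order_emb L M f)"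


section \<open>CF- and L-approximation spaces\<close>

definition upper_approx :: "'u set \<Rightarrow> ('u \<times> 'u) set \<Rightarrow> 'u set \<Rightarrow> 'u set" where
  "upper_approx U R A = {x \<in> U. \<exists>y\<in>A. (x, y) \<in> R}"

locale CF_approximation_space =
  fixes U :: "'u set" and R :: "('u \<times> 'u) set" and \<F> :: "'u set set"
  assumes rel_on: "R \<subseteq> U \<times> U"
    and trans_rel: "trans R"
    and family_nonempty: "\<F> \<noteq> {}"
    and family_finite_subsets: "F \<in> \<F> \<Longrightarrow> finite F \<and> F \<subseteq> U"
    and CF_interpolation:
      "F \<in> \<F> \<Longrightarrow> finite K \<Longrightarrow> K \<subseteq> upper_approx U R F \<Longrightarrow>
         \<exists>G\<in>\<F>. K \<subseteq> upper_approx U R G \<and> G \<subseteq> upper_approx U R F"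

definition join_saturation :: "'u set set \<Rightarrow> 'u set set" where
  "join_saturation \<F> = {\<Union>\<A> |\<A>. \<A> \<subseteq> \<F> \<and> finite \<A> \<and> \<A> \<noteq> {}}"

locale L_approximation_space = CF_approximation_space +
  assumes L_interpolation:
    "M \<in> join_saturation \<F> \<union> {{}} \<Longrightarrow> F \<in> \<F> \<Longrightarrow> M \<subseteq> upper_approx U R F \<Longrightarrow>
       \<exists>G\<in>\<F>.
         upper_approx U R M \<subseteq> upper_approx U R G \<and>
         upper_approx U R G \<subseteq> upper_approx U R F \<and>
         (\<forall>G'\<in>\<F>.
            upper_approx U R M \<subseteq> upper_approx U R G' \<and>
            upper_approx U R G' \<subseteq> upper_approx U R F \<longrightarrow>
            upper_approx U R G \<subseteq> upper_approx U R G')"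

definition CF_closed :: "'u set \<Rightarrow> ('u \<times> 'u) set \<Rightarrow> 'u set set \<Rightarrow> 'u set \<Rightarrow> bool" where
  "CF_closed U R \<F> E \<longleftrightarrow>
     E \<subseteq> U \<and>
     (\<forall>K. finite K \<and> K \<subseteq> E \<longrightarrow>
        (\<exists>F\<in>\<F>. K \<subseteq> upper_approx U R F \<and> upper_approx U R F \<subseteq> E \<and> F \<subseteq> E))"

definition CF_closed_sets :: "'u set \<Rightarrow> ('u \<times> 'u) set \<Rightarrow> 'u set set \<Rightarrow> 'u set gorder" where
  "CF_closed_sets U R \<F> = \<lparr>carrier = {E. CF_closed U R \<F> E}, eq = (=), le = (\<subseteq>)\<rparr>"

text \<open>
  HOL cannot quantify over the type that holds \<open>U\<close> inside a formula. A statement that an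
  approximation space exists is therefore made with \<open>U\<close> in the type of the poset itself, and a
  statement that assumes one is made for \<open>U\<close> in an arbitrary type.

  Posets are nonempty: the family \<open>\<F>\<close> is nonempty and the upper approximation of each member is
  CF-closed, so the poset of CF-closed sets is never empty, whereas an empty partial order
  satisfies \<open>L_domain\<close> vacuously.
\<close>

end

theory Submission
  imports Defs
begin

text \<open>
  Write \<open>R\<^sup>-F\<close> for the upper approximation of \<open>F\<close>. In a CF-approximation space the sets
  \<open>R\<^sup>-F\<close> with \<open>F \<in> \<F>\<close> and \<open>F \<subseteq> E\<close> form a directed family with union \<open>E\<close>, for every CF-closed
  \<open>E\<close>, and suprema of directed families of CF-closed sets are unions. Hence \<open>E \<lless> E'\<close> iff
  \<open>E \<subseteq> R\<^sup>-F\<close> for some \<open>F \<in> \<F>\<close> with \<open>F \<subseteq> E'\<close>, and the CF-closed sets form a continuous domain.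
  The set \<open>R\<^sup>-G\<close> provided by the L-condition does not depend on \<open>F\<close> as long as \<open>F\<close> is contained
  in a fixed CF-closed set \<open>E\<close>; the supremum inside the ideal of \<open>E\<close> of a family of CF-closed sets
  is the directed union of these \<open>R\<^sup>-G\<close>, where \<open>M\<close> ranges over the finite unions of members of
  \<open>\<F>\<close> that are contained in a set of the family.

  Conversely, an L-domain is represented by its own carrier with the way-below relation and the
  family of all singletons: the CF-closed sets are exactly the sets of all elements way below a
  fixed one, and the \<open>G\<close> of the L-condition is the supremum of \<open>M\<close> in a principal ideal.
\<close>

section \<open>Orders, suprema and isomorphisms\<close>

lemma directed_inD:
  assumes "directed_in L D"
  shows "D \<subseteq> carrier L" "D \<noteq> {}"
    "x \<in> D \<Longrightarrow> y \<in> D \<Longrightarrow> \<exists>z\<in>D. x \<sqsubseteq>\<^bsub>L\<^esub> z \<and> y \<sqsubseteq>\<^bsub>L\<^esub> z"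
  using assms unfolding directed_in_def by blast+

text \<open>\<open>Upper\<close> only tests against the members of \<open>A\<close> that lie in the
  carrier. For \<open>A\<close> inside the carrier this restriction vanishes, and suprema get an
  elementary form.\<close>

lemma is_lub_iff:
  assumes "A \<subseteq> carrier L"
  shows "is_lub L s A \<longleftrightarrow>
    s \<in> carrier L \<and> (\<forall>a\<in>A. a \<sqsubseteq>\<^bsub>L\<^esub> s) \<and>
    (\<forall>u\<in>carrier L. (\<forall>a\<in>A. a \<sqsubseteq>\<^bsub>L\<^esub> u) \<longrightarrow> s \<sqsubseteq>\<^bsub>L\<^esub> u)"
proof -
  have "Upper L A = {u \<in> carrier L. \<forall>a\<in>A. a \<sqsubseteq>\<^bsub>L\<^esub> u}"
    using assms by (auto simp: Upper_def)
  then show ?thesis by (auto simp: least_def)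
qed

lemma partial_order_subset:
  assumes "partial_order L" and "C \<subseteq> carrier L"
  shows "partial_order (L\<lparr>carrier := C\<rparr>)"
proof -
  interpret partial_order L by fact
  interpret C: weak_partial_order "L\<lparr>carrier := C\<rparr>"
    by (rule weak_partial_order_subset) (use weak_partial_order_axioms assms in auto)
  show ?thesis
    by unfold_locales (simp add: eq_is_equal)
qed

text \<open>The infimum of \<open>A\<close> is the supremum of the lower bounds of
  \<open>A\<close>.\<close>

lemma (in partial_order) complete_lattice_if_sups:
  assumes sups: "\<And>A. A \<subseteq> carrier L \<Longrightarrow> \<exists>s. is_lub L s A"
  shows "complete_lattice L"
proof
  fix A assume A: "A \<subseteq> carrier L"
  show "\<exists>s. is_lub L s A" using sups[OF A] .
  obtain i where i: "is_lub L i (Lower L A)"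
    using sups[of "Lower L A"] by auto
  have "is_glb L i A"
  proof (rule greatest_LowerI[OF _ _ A])
    show "i \<in> carrier L" using i by auto
    show "i \<sqsubseteq> x" if "x \<in> A" for x
      using i that A by (intro least_le[OF i] Upper_memI) auto
    show "y \<sqsubseteq> i" if "y \<in> Lower L A" for y
      using i that by (intro least_Upper_above[OF i]) auto
  qed
  then show "\<exists>i. is_glb L i A" ..
qed

section \<open>Transport along order isomorphisms\<close>

lemma is_lub_order_iso_iff:
  assumes f: "bij_betw f (carrier L) (carrier M)" and emb: "order_emb L M f"
    and A: "A \<subseteq> carrier L" and s: "s \<in> carrier L"
  shows "is_lub M (f s) (f ` A) \<longleftrightarrow> is_lub L s A"
proof -
  \<comment> \<open>Writing \<open>carrier M\<close> as an image turns quantifiers over it into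
    quantifiers over \<open>carrier L\<close>, where the embedding converts each inequality.\<close>
  have img: "f ` carrier L = carrier M" using f by (simp add: bij_betw_def)
  have fA: "f ` A \<subseteq> carrier M" unfolding img[symmetric] using A by (rule image_mono)
  have le: "f x \<sqsubseteq>\<^bsub>M\<^esub> f y \<longleftrightarrow> x \<sqsubseteq>\<^bsub>L\<^esub> y" if "x \<in> carrier L" "y \<in> carrier L" for x y
    using emb that by (simp add: order_emb_def)
  have upper: "(\<forall>a\<in>A. f a \<sqsubseteq>\<^bsub>M\<^esub> f u) \<longleftrightarrow> (\<forall>a\<in>A. a \<sqsubseteq>\<^bsub>L\<^esub> u)" if "u \<in> carrier L" for u
    using subsetD[OF A] that by (simp add: le)
  have "is_lub M (f s) (f ` A) \<longleftrightarrow>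
      (\<forall>b\<in>f ` A. b \<sqsubseteq>\<^bsub>M\<^esub> f s) \<and> (\<forall>u\<in>carrier L. (\<forall>b\<in>f ` A. b \<sqsubseteq>\<^bsub>M\<^esub> f u) \<longrightarrow> f s \<sqsubseteq>\<^bsub>M\<^esub> f u)"
    unfolding is_lub_iff[OF fA] unfolding img[symmetric] using s by simp
  also have "\<dots> \<longleftrightarrow> is_lub L s A"
    unfolding is_lub_iff[OF A] using s by (simp add: upper le cong: ball_cong)
  finally show ?thesis .
qed

lemma directed_in_order_iso_iff:
  assumes f: "bij_betw f (carrier L) (carrier M)" and emb: "order_emb L M f"
    and D: "D \<subseteq> carrier L"
  shows "directed_in M (f ` D) \<longleftrightarrow> directed_in L D"
proof -
  have img: "f ` carrier L = carrier M" using f by (simp add: bij_betw_def)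
  have le: "f x \<sqsubseteq>\<^bsub>M\<^esub> f y \<longleftrightarrow> x \<sqsubseteq>\<^bsub>L\<^esub> y" if "x \<in> D" "y \<in> D" for x y
    using emb that subsetD[OF D] by (simp add: order_emb_def)
  have "f ` D \<subseteq> carrier M" unfolding img[symmetric] using D by (rule image_mono)
  then show ?thesis
    using D by (simp add: directed_in_def le)
qed

text \<open>Every directed subset of \<open>carrier M\<close> and its supremum are images under
  \<open>f\<close>, so both relations are tested against corresponding directed sets.\<close>

lemma way_below_order_iso_iff:
  assumes f: "bij_betw f (carrier L) (carrier M)" and emb: "order_emb L M f"
    and x: "x \<in> carrier L" and y: "y \<in> carrier L"
  shows "way_below M (f x) (f y) \<longleftrightarrow> way_below L x y"
proof -
  have img: "f ` carrier L = carrier M" using f by (simp add: bij_betw_def)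
  have le: "f x \<sqsubseteq>\<^bsub>M\<^esub> f y \<longleftrightarrow> x \<sqsubseteq>\<^bsub>L\<^esub> y" if "x \<in> carrier L" "y \<in> carrier L" for x y
    using emb that by (simp add: order_emb_def)
  show ?thesis
  proof
    assume wb: "way_below M (f x) (f y)"
    show "way_below L x y"
      unfolding way_below_def
    proof (intro allI impI, elim conjE)
      fix D s assume D: "directed_in L D" and s: "is_lub L s D" and "y \<sqsubseteq>\<^bsub>L\<^esub> s"
      have D': "D \<subseteq> carrier L" and s': "s \<in> carrier L"
        using D s by (auto simp: directed_in_def)
      have "directed_in M (f ` D)" "is_lub M (f s) (f ` D)" "f y \<sqsubseteq>\<^bsub>M\<^esub> f s"
        using D s \<open>y \<sqsubseteq>\<^bsub>L\<^esub> s\<close> y s' D' f emb le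
        by (simp_all add: directed_in_order_iso_iff is_lub_order_iso_iff)
      then obtain d where "d \<in> D" "f x \<sqsubseteq>\<^bsub>M\<^esub> f d"
        using wb unfolding way_below_def by blast
      then show "\<exists>d\<in>D. x \<sqsubseteq>\<^bsub>L\<^esub> d" using le x D' by blast
    qed
  next
    assume wb: "way_below L x y"
    show "way_below M (f x) (f y)"
      unfolding way_below_def
    proof (intro allI impI, elim conjE)
      fix D s assume D: "directed_in M D" and s: "is_lub M s D" and "f y \<sqsubseteq>\<^bsub>M\<^esub> s"
      have "D \<subseteq> f ` carrier L" and "s \<in> f ` carrier L"
        using D s by (auto simp: directed_in_def img)
      then obtain D' s' where D': "D' \<subseteq> carrier L" "D = f ` D'" and s': "s' \<in> carrier L" "s = f s'"
        by (auto simp: subset_image_iff)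
      have "directed_in L D'" "is_lub L s' D'" "y \<sqsubseteq>\<^bsub>L\<^esub> s'"
        using D s \<open>f y \<sqsubseteq>\<^bsub>M\<^esub> s\<close> y s' D' f emb le
        by (simp_all add: directed_in_order_iso_iff is_lub_order_iso_iff)
      then obtain d where "d \<in> D'" "x \<sqsubseteq>\<^bsub>L\<^esub> d"
        using wb unfolding way_below_def by blast
      then show "\<exists>d\<in>D. f x \<sqsubseteq>\<^bsub>M\<^esub> d" using le x D' by blast
    qed
  qed
qed

text \<open>\<open>order_emb\<close> only provides weak partial orders, whose equality may be a mere
  equivalence; that \<open>L\<close> is a genuine partial order is therefore assumed
  separately.\<close>

lemma complete_lattice_order_isomorphic:
  assumes L: "partial_order L" and iso: "order_isomorphic L M" and M: "complete_lattice M"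
  shows "complete_lattice L"
proof -
  obtain f where f: "bij_betw f (carrier L) (carrier M)" and emb: "order_emb L M f"
    using iso by (auto simp: order_isomorphic_def)
  have img: "f ` carrier L = carrier M" using f by (simp add: bij_betw_def)
  interpret L: partial_order L by fact
  interpret M: complete_lattice M by fact
  show ?thesis
  proof (rule L.complete_lattice_if_sups)
    fix A assume A: "A \<subseteq> carrier L"
    then have "f ` A \<subseteq> carrier M" unfolding img[symmetric] by (rule image_mono)
    then obtain t where t: "is_lub M t (f ` A)" using M.sup_exists by blast
    then have "t \<in> f ` carrier L" using img by auto
    then obtain s where "s \<in> carrier L" "t = f s" by blast
    then show "\<exists>s. is_lub L s A" using t is_lub_order_iso_iff[OF f emb A] by blast
  qed
qed

lemma L_domain_order_isomorphic:
  assumes L: "partial_order L" and iso: "order_isomorphic L M" and M: "L_domain M"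
  shows "L_domain L"
proof -
  obtain f where f: "bij_betw f (carrier L) (carrier M)" and emb: "order_emb L M f"
    using iso by (auto simp: order_isomorphic_def)
  have img: "f ` carrier L = carrier M" using f by (simp add: bij_betw_def)
  have le: "f x \<sqsubseteq>\<^bsub>M\<^esub> f y \<longleftrightarrow> x \<sqsubseteq>\<^bsub>L\<^esub> y" if "x \<in> carrier L" "y \<in> carrier L" for x y
    using emb that by (simp add: order_emb_def)
  have cont: "continuous_domain M" and M_po: "partial_order M"
    using M by (auto simp: L_domain_def continuous_domain_def dcpo_def)
  have "\<exists>s. is_lub L s D" if D: "directed_in L D" for D
  proof -
    have D': "D \<subseteq> carrier L" using D by (auto simp: directed_in_def)
    have "directed_in M (f ` D)" using D D' f emb by (simp add: directed_in_order_iso_iff)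
    then obtain t where t: "is_lub M t (f ` D)"
      using cont by (auto simp: continuous_domain_def dcpo_def)
    then have "t \<in> f ` carrier L" using img by auto
    then obtain s where "s \<in> carrier L" "t = f s" by blast
    then show ?thesis using t is_lub_order_iso_iff[OF f emb D'] by blast
  qed
  moreover have "directed_in L {y \<in> carrier L. way_below L y x} \<and>
      is_lub L x {y \<in> carrier L. way_below L y x}" if x: "x \<in> carrier L" for x
  proof -
    have sub: "{y \<in> carrier L. way_below L y x} \<subseteq> carrier L" by blast
    have "f ` {y \<in> carrier L. way_below L y x} = {z \<in> carrier M. way_below M z (f x)}"
      using x by (auto simp: img[symmetric] way_below_order_iso_iff[OF f emb])
    then have "directed_in M (f ` {y \<in> carrier L. way_below L y x})"
      "is_lub M (f x) (f ` {y \<in> carrier L. way_below L y x})"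
      using cont x img by (auto simp: continuous_domain_def)
    then show ?thesis
      using directed_in_order_iso_iff[OF f emb sub] is_lub_order_iso_iff[OF f emb sub x] by blast
  qed
  \<comment> \<open>The restriction of \<open>f\<close> is an isomorphism from the ideal of
    \<open>x\<close> onto the ideal of \<open>f x\<close>.\<close>
  moreover have "complete_lattice (L\<lparr>carrier := {y \<in> carrier L. y \<sqsubseteq>\<^bsub>L\<^esub> x}\<rparr>)"
    (is "complete_lattice ?Lx") if x: "x \<in> carrier L" for x
  proof (rule complete_lattice_order_isomorphic)
    let ?Mx = "M\<lparr>carrier := {z \<in> carrier M. z \<sqsubseteq>\<^bsub>M\<^esub> f x}\<rparr>"
    have img_x: "f ` {y \<in> carrier L. y \<sqsubseteq>\<^bsub>L\<^esub> x} = {z \<in> carrier M. z \<sqsubseteq>\<^bsub>M\<^esub> f x}"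
      using x by (auto simp: img[symmetric] le)
    show Lx_po: "partial_order ?Lx"
      using L by (rule partial_order_subset) blast
    have Mx_po: "partial_order ?Mx"
      using M_po by (rule partial_order_subset) blast
    have "bij_betw f (carrier ?Lx) (carrier ?Mx)"
      using inj_on_subset[of f "carrier L" "carrier ?Lx"] f img_x by (simp add: bij_betw_def)
    moreover have "order_emb ?Lx ?Mx f"
      using Lx_po Mx_po le by (simp add: order_emb_def partial_order_def)
    ultimately show "order_isomorphic ?Lx ?Mx"
      unfolding order_isomorphic_def by blast
    show "complete_lattice ?Mx"
      using M x img by (auto simp: L_domain_def)
  qed
  ultimately show ?thesis
    using L by (simp add: L_domain_def continuous_domain_def dcpo_def)
qed

section \<open>CF-closed sets form a continuous domain\<close>

lemma upper_approx_mono: "A \<subseteq> B \<Longrightarrow> upper_approx U R A \<subseteq> upper_approx U R B"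
  by (auto simp: upper_approx_def)

lemma partial_order_CF_closed_sets: "partial_order (CF_closed_sets U R \<F>)"
  by unfold_locales (auto simp: CF_closed_sets_def)

lemma carrier_CF_closed_sets [simp]: "carrier (CF_closed_sets U R \<F>) = {E. CF_closed U R \<F> E}"
  and le_CF_closed_sets [simp]: "le (CF_closed_sets U R \<F>) = (\<subseteq>)"
  by (simp_all add: CF_closed_sets_def)

lemma CF_closedD:
  assumes "CF_closed U R \<F> E" "finite K" "K \<subseteq> E"
  shows "\<exists>F\<in>\<F>. K \<subseteq> upper_approx U R F \<and> upper_approx U R F \<subseteq> E \<and> F \<subseteq> E"
  using assms by (auto simp: CF_closed_def)

text \<open>A finite subset of a directed union already lies in one member, and the closedness of
  that member supplies the required \<open>F\<close>.\<close>

lemma CF_closed_Union_directed: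
  assumes "\<D> \<noteq> {}" and closed: "\<And>D. D \<in> \<D> \<Longrightarrow> CF_closed U R \<F> D"
    and directed: "\<And>D D'. D \<in> \<D> \<Longrightarrow> D' \<in> \<D> \<Longrightarrow> \<exists>D''\<in>\<D>. D \<subseteq> D'' \<and> D' \<subseteq> D''"
  shows "CF_closed U R \<F> (\<Union>\<D>)"
    and "finite K \<Longrightarrow> K \<subseteq> \<Union>\<D> \<Longrightarrow> \<exists>D\<in>\<D>. K \<subseteq> D"
proof -
  show fin: "\<exists>D\<in>\<D>. K \<subseteq> D" if "finite K" "K \<subseteq> \<Union>\<D>" for K
    using that
  proof (induction K)
    case empty
    then show ?case using \<open>\<D> \<noteq> {}\<close> by blast
  next
    case (insert k K)
    then obtain D D' where "D \<in> \<D>" "K \<subseteq> D" "D' \<in> \<D>" "k \<in> D'" by blast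
    with directed[of D D'] show ?case by blast
  qed
  show "CF_closed U R \<F> (\<Union>\<D>)"
    unfolding CF_closed_def
  proof (intro conjI allI impI)
    show "\<Union>\<D> \<subseteq> U" using closed by (auto simp: CF_closed_def)
    fix K assume "finite K \<and> K \<subseteq> \<Union>\<D>"
    then obtain D where "D \<in> \<D>" "K \<subseteq> D" "finite K" using fin by blast
    with closed CF_closedD[of U R \<F> D K]
    show "\<exists>F\<in>\<F>. K \<subseteq> upper_approx U R F \<and> upper_approx U R F \<subseteq> \<Union>\<D> \<and> F \<subseteq> \<Union>\<D>"
      by (meson Union_upper order_trans)
  qed
qed

lemma directed_CF_closed_Union:
  assumes D: "directed_in (CF_closed_sets U R \<F>) \<D>"
  shows "CF_closed U R \<F> (\<Union>\<D>)"
    and "finite K \<Longrightarrow> K \<subseteq> \<Union>\<D> \<Longrightarrow> \<exists>D\<in>\<D>. K \<subseteq> D"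
proof -
  have ne: "\<D> \<noteq> {}" and closed: "\<And>D. D \<in> \<D> \<Longrightarrow> CF_closed U R \<F> D"
    and dir: "\<And>D D'. D \<in> \<D> \<Longrightarrow> D' \<in> \<D> \<Longrightarrow> \<exists>D''\<in>\<D>. D \<subseteq> D'' \<and> D' \<subseteq> D''"
    using D by (auto simp: directed_in_def)
  show "CF_closed U R \<F> (\<Union>\<D>)"
    by (rule CF_closed_Union_directed(1)[OF ne closed dir])
  show "finite K \<Longrightarrow> K \<subseteq> \<Union>\<D> \<Longrightarrow> \<exists>D\<in>\<D>. K \<subseteq> D"
    by (rule CF_closed_Union_directed(2)[OF ne closed dir])
qed

lemma is_lub_directed_Union:
  assumes D: "directed_in (CF_closed_sets U R \<F>) \<D>"
  shows "is_lub (CF_closed_sets U R \<F>) (\<Union>\<D>) \<D>"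
proof -
  have "\<D> \<subseteq> carrier (CF_closed_sets U R \<F>)" using D by (simp add: directed_in_def)
  from is_lub_iff[OF this] directed_CF_closed_Union(1)[OF D] show ?thesis by auto
qed

context CF_approximation_space
begin

abbreviation ua :: "'u set \<Rightarrow> 'u set" where
  "ua \<equiv> upper_approx U R"

abbreviation CF :: "'u set gorder" where
  "CF \<equiv> CF_closed_sets U R \<F>"

lemma ua_ua: "A \<subseteq> ua B \<Longrightarrow> ua A \<subseteq> ua B"
  using trans_rel by (fastforce simp: upper_approx_def dest: transD)

text \<open>Interpolation yields \<open>G\<close> with \<open>K \<subseteq> ua G\<close> and
  \<open>G \<subseteq> ua F\<close>; transitivity, in the form \<open>ua_ua\<close>, adds
  \<open>ua G \<subseteq> ua F\<close>.\<close>

lemma CF_closed_ua: "F \<in> \<F> \<Longrightarrow> CF_closed U R \<F> (ua F)"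
  unfolding CF_closed_def
proof (intro conjI allI impI)
  fix K assume F: "F \<in> \<F>" and "finite K \<and> K \<subseteq> ua F"
  then show "\<exists>G\<in>\<F>. K \<subseteq> ua G \<and> ua G \<subseteq> ua F \<and> G \<subseteq> ua F"
    using CF_interpolation[OF F, of K] ua_ua by meson
qed (auto simp: upper_approx_def)

text \<open>An element of \<open>ua A\<close> lies in \<open>ua {y}\<close> for a single
  \<open>y\<close> in \<open>A\<close>, so closedness at singletons suffices and \<open>A\<close>
  may be infinite.\<close>

lemma ua_subset_CF_closed:
  assumes E: "CF_closed U R \<F> E" and A: "A \<subseteq> E"
  shows "ua A \<subseteq> E"
proof
  fix x assume "x \<in> ua A"
  then obtain y where "y \<in> A" and x: "x \<in> ua {y}" by (auto simp: upper_approx_def)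
  then obtain F where "{y} \<subseteq> ua F" "ua F \<subseteq> E" using CF_closedD[OF E, of "{y}"] A by auto
  then have "ua {y} \<subseteq> E" using ua_ua[of "{y}" F] by (meson order_trans)
  with x show "x \<in> E" by (rule rev_subsetD)
qed

text \<open>Closedness is applied to the finite set \<open>F \<union> G\<close>. Together with
  \<open>ua_ua\<close> this makes the sets \<open>ua F\<close> with \<open>F \<subseteq> E\<close>
  directed.\<close>

lemma CF_closed_common:
  assumes E: "CF_closed U R \<F> E" and F: "F \<in> \<F>" "F \<subseteq> E" and G: "G \<in> \<F>" "G \<subseteq> E"
  obtains H where "H \<in> \<F>" "H \<subseteq> E" "F \<subseteq> ua H" "G \<subseteq> ua H"
proof -
  have "finite (F \<union> G)" "F \<union> G \<subseteq> E" using F G family_finite_subsets by auto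
  from CF_closedD[OF E this] that show ?thesis by blast
qed

text \<open>Forwards, the relation is tested against the directed family of all \<open>ua F\<close>
  with \<open>F \<subseteq> E\<close>, which covers \<open>E\<close>. Backwards, the finite set
  \<open>F\<close> lies in one member of any directed family whose union contains \<open>E\<close>,
  and that closed member then contains \<open>ua F\<close>.\<close>

lemma way_below_CF_iff:
  assumes E: "CF_closed U R \<F> E"
  shows "way_below CF D E \<longleftrightarrow> (\<exists>F\<in>\<F>. F \<subseteq> E \<and> D \<subseteq> ua F)"
proof
  let ?\<D> = "ua ` {F \<in> \<F>. F \<subseteq> E}"
  assume wb: "way_below CF D E"
  \<comment> \<open>Closedness at \<open>K = {}\<close> provides a member of the family inside
    \<open>E\<close>, even when \<open>E\<close> is empty.\<close>
  have "?\<D> \<noteq> {}" using CF_closedD[OF E, of "{}"] by auto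
  moreover have "\<exists>z\<in>?\<D>. x \<subseteq> z \<and> y \<subseteq> z" if xy: "x \<in> ?\<D>" "y \<in> ?\<D>" for x y
  proof -
    obtain F G where F: "x = ua F" "F \<in> \<F>" "F \<subseteq> E" and G: "y = ua G" "G \<in> \<F>" "G \<subseteq> E"
      using xy by auto
    from CF_closed_common[OF E F(2,3) G(2,3)]
    obtain H where "H \<in> \<F>" "H \<subseteq> E" "F \<subseteq> ua H" "G \<subseteq> ua H" .
    then have "ua H \<in> ?\<D>" "x \<subseteq> ua H" "y \<subseteq> ua H" using F(1) G(1) ua_ua by simp_all
    then show ?thesis by blast
  qed
  ultimately have dir: "directed_in CF ?\<D>"
    by (auto simp: directed_in_def CF_closed_ua)
  have "E \<subseteq> \<Union>?\<D>"
  proof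
    fix x assume "x \<in> E"
    then show "x \<in> \<Union>?\<D>" using CF_closedD[OF E, of "{x}"] by auto
  qed
  moreover have "is_lub CF (\<Union>?\<D>) ?\<D>"
    using dir by (rule is_lub_directed_Union)
  ultimately obtain d where "d \<in> ?\<D>" "D \<subseteq> d"
    using wb[unfolded way_below_def le_CF_closed_sets, rule_format, of ?\<D> "\<Union>?\<D>"] dir by blast
  then show "\<exists>F\<in>\<F>. F \<subseteq> E \<and> D \<subseteq> ua F" by auto
next
  assume "\<exists>F\<in>\<F>. F \<subseteq> E \<and> D \<subseteq> ua F"
  then obtain F where F: "F \<in> \<F>" "F \<subseteq> E" "D \<subseteq> ua F" by blast
  show "way_below CF D E"
    unfolding way_below_def
  proof (intro allI impI, elim conjE)
    fix \<D> S assume dir: "directed_in CF \<D>" and S: "is_lub CF S \<D>" and ES: "E \<sqsubseteq>\<^bsub>CF\<^esub> S"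
    have closed: "\<And>D. D \<in> \<D> \<Longrightarrow> CF_closed U R \<F> D" using dir by (auto simp: directed_in_def)
    have "is_lub CF (\<Union>\<D>) \<D>"
      using dir by (rule is_lub_directed_Union)
    then have "S = \<Union>\<D>"
      by (rule partial_order.least_unique[OF partial_order_CF_closed_sets S])
    then have "F \<subseteq> \<Union>\<D>" "finite F" using F ES family_finite_subsets by simp_all
    then obtain d where d: "d \<in> \<D>" "F \<subseteq> d"
      using directed_CF_closed_Union(2)[OF dir] by blast
    have "D \<subseteq> d"
      using F(3) ua_subset_CF_closed[OF closed[OF d(1)] d(2)] by (rule order_trans)
    then show "\<exists>d\<in>\<D>. D \<sqsubseteq>\<^bsub>CF\<^esub> d" using d(1) by auto
  qed
qed

lemma continuous_domain_CF: "continuous_domain CF"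
proof -
  have "\<exists>S. is_lub CF S \<D>" if dir: "directed_in CF \<D>" for \<D>
    using is_lub_directed_Union[OF dir] by (rule exI)
  moreover have "directed_in CF {D \<in> carrier CF. way_below CF D E} \<and>
      is_lub CF E {D \<in> carrier CF. way_below CF D E}" if "E \<in> carrier CF" for E
  proof -
    have E: "CF_closed U R \<F> E" using that by simp
    let ?W = "{D. CF_closed U R \<F> D \<and> (\<exists>F\<in>\<F>. F \<subseteq> E \<and> D \<subseteq> ua F)}"
    have W: "{D \<in> carrier CF. way_below CF D E} = ?W"
      by (simp add: way_below_CF_iff[OF E])
    have ua_W: "ua F \<in> ?W" if "F \<in> \<F>" "F \<subseteq> E" for F
      using that CF_closed_ua by blast
    have "?W \<noteq> {}" using CF_closedD[OF E, of "{}"] ua_W by blast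
    moreover have "\<exists>z\<in>?W. x \<subseteq> z \<and> y \<subseteq> z" if xy: "x \<in> ?W" "y \<in> ?W" for x y
    proof -
      obtain F G where F: "x \<subseteq> ua F" "F \<in> \<F>" "F \<subseteq> E" and G: "y \<subseteq> ua G" "G \<in> \<F>" "G \<subseteq> E"
        using xy by auto
      from CF_closed_common[OF E F(2,3) G(2,3)]
      obtain H where H: "H \<in> \<F>" "H \<subseteq> E" "F \<subseteq> ua H" "G \<subseteq> ua H" .
      then have "x \<subseteq> ua H" "y \<subseteq> ua H" 
        using order_trans[OF F(1) ua_ua] order_trans[OF G(1) ua_ua] by simp_all
      with ua_W[OF H(1,2)] show ?thesis by blast
    qed
    ultimately have "directed_in CF ?W"
      by (auto simp: directed_in_def)
    moreover have "is_lub CF E ?W"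
    proof (subst is_lub_iff, safe)
      show "E \<in> carrier CF" using that .
      show "D \<sqsubseteq>\<^bsub>CF\<^esub> E" if "CF_closed U R \<F> D" "F \<in> \<F>" "F \<subseteq> E" "D \<subseteq> ua F" for D F
        using that ua_subset_CF_closed[OF E, of F] by auto
      \<comment> \<open>Each \<open>ua F\<close> with \<open>F \<subseteq> E\<close> belongs to
        \<open>?W\<close>, and by closedness at singletons these sets cover \<open>E\<close>; so an
        upper bound of \<open>?W\<close> contains \<open>E\<close>.\<close>
      fix B assume "\<forall>D\<in>?W. D \<sqsubseteq>\<^bsub>CF\<^esub> B"
      then have B: "ua F \<subseteq> B" if "F \<in> \<F>" "F \<subseteq> E" for F
        using ua_W[OF that] unfolding le_CF_closed_sets by blast
      have "x \<in> B" if "x \<in> E" for x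
        using CF_closedD[OF E, of "{x}"] that B by blast
      then show "E \<sqsubseteq>\<^bsub>CF\<^esub> B" by auto
    qed auto
    ultimately show ?thesis unfolding W by simp
  qed
  ultimately show ?thesis
    by (simp add: continuous_domain_def dcpo_def partial_order_CF_closed_sets)
qed

end

section \<open>Suprema inside principal ideals\<close>

context L_approximation_space
begin

text \<open>
  The candidates \<open>G'\<close> are bounded by some \<open>F \<subseteq> E\<close> and not merely by \<open>E\<close>, since the L-condition
  only compares sets below a common \<open>ua F\<close>.
\<close>

definition least_above :: "'a set \<Rightarrow> 'a set \<Rightarrow> 'a set \<Rightarrow> bool" where
  "least_above E M G \<longleftrightarrow>
     G \<in> \<F> \<and> ua M \<subseteq> ua G \<and> (\<exists>F\<in>\<F>. F \<subseteq> E \<and> ua G \<subseteq> ua F) \<and>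
     (\<forall>G'\<in>\<F>. \<forall>F\<in>\<F>. ua M \<subseteq> ua G' \<and> F \<subseteq> E \<and> ua G' \<subseteq> ua F \<longrightarrow> ua G \<subseteq> ua G')"

text \<open>\<open>G\<close> is chosen least below one \<open>ua F\<close>. A competitor
  \<open>G'\<close> below another \<open>ua F'\<close> is compared through \<open>H\<close> with
  both \<open>ua F\<close> and \<open>ua F'\<close> inside \<open>ua H\<close>: the least solution
  \<open>G1\<close> below \<open>ua H\<close> satisfies \<open>ua G1 \<subseteq> ua G\<close>, hence
  it competes below \<open>ua F\<close> and
  \<open>ua G \<subseteq> ua G1 \<subseteq> ua G'\<close>.\<close>

lemma least_above_exists:
  assumes M: "M \<in> join_saturation \<F> \<union> {{}}" and E: "CF_closed U R \<F> E" and ME: "M \<subseteq> E"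
    and "finite M"
  shows "\<exists>G. least_above E M G"
proof -
  obtain F where F: "F \<in> \<F>" "M \<subseteq> ua F" "F \<subseteq> E"
    using CF_closedD[OF E \<open>finite M\<close> ME] by blast
  obtain G where G: "G \<in> \<F>" "ua M \<subseteq> ua G" "ua G \<subseteq> ua F"
    and least: "\<And>G'. G' \<in> \<F> \<Longrightarrow> ua M \<subseteq> ua G' \<Longrightarrow> ua G' \<subseteq> ua F \<Longrightarrow> ua G \<subseteq> ua G'"
    using L_interpolation[OF M F(1,2)] by blast
  have "ua G \<subseteq> ua G'" if G': "G' \<in> \<F>" "ua M \<subseteq> ua G'" and F': "F' \<in> \<F>" "F' \<subseteq> E" "ua G' \<subseteq> ua F'"
    for G' F'
  proof -
    from CF_closed_common[OF E F(1,3) F'(1,2)]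
    obtain H where H: "H \<in> \<F>" "H \<subseteq> E" "F \<subseteq> ua H" "F' \<subseteq> ua H" .
    then have FH: "ua F \<subseteq> ua H" and F'H: "ua F' \<subseteq> ua H" using ua_ua by simp_all
    have "M \<subseteq> ua H" using F(2) FH by blast
    from L_interpolation[OF M H(1) this]
    obtain G1 where G1: "G1 \<in> \<F>" "ua M \<subseteq> ua G1"
      and least1: "\<And>G'. G' \<in> \<F> \<Longrightarrow> ua M \<subseteq> ua G' \<Longrightarrow> ua G' \<subseteq> ua H \<Longrightarrow> ua G1 \<subseteq> ua G'"
      by blast
    have "ua G1 \<subseteq> ua G" using least1 G FH by blast
    then have "ua G \<subseteq> ua G1" using least G1 G(3) by blast
    also have "\<dots> \<subseteq> ua G'" using least1 G' F'(3) F'H by blast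
    finally show ?thesis .
  qed
  then have "least_above E M G" using F G unfolding least_above_def by blast
  then show ?thesis ..
qed

lemma complete_lattice_CF_ideal:
  assumes E: "CF_closed U R \<F> E"
  shows "complete_lattice (CF\<lparr>carrier := {D \<in> carrier CF. D \<sqsubseteq>\<^bsub>CF\<^esub> E}\<rparr>)"
    (is "complete_lattice ?I")
proof -
  interpret I: partial_order ?I
    by (rule partial_order_subset[OF partial_order_CF_closed_sets]) blast
  show ?thesis
  proof (rule I.complete_lattice_if_sups)
    fix \<A> assume A: "\<A> \<subseteq> carrier ?I"
    then have A_closed: "CF_closed U R \<F> A" and AE: "A \<subseteq> E" if "A \<in> \<A>" for A
      using that by auto
    \<comment> \<open>Members of one family may lie in different sets of \<open>\<A>\<close>.
      Indexing by finite families makes \<open>\<M>\<close> closed under binary union, and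
      \<open>\<Union>\<G>\<close> serves as the \<open>M\<close> of the L-condition.\<close>
    define \<M> where "\<M> = {\<G>. finite \<G> \<and> \<G> \<subseteq> {F \<in> \<F>. \<exists>A\<in>\<A>. F \<subseteq> A}}"
    have "\<forall>\<G>\<in>\<M>. \<exists>G. least_above E (\<Union>\<G>) G"
    proof
      fix \<G> assume G: "\<G> \<in> \<M>"
      have "\<Union>\<G> \<in> join_saturation \<F> \<union> {{}}"
        using G unfolding \<M>_def join_saturation_def by (cases "\<G> = {}") auto
      moreover have "\<Union>\<G> \<subseteq> E" using G AE unfolding \<M>_def by blast
      moreover have "finite (\<Union>\<G>)" using G family_finite_subsets unfolding \<M>_def by blast
      ultimately show "\<exists>G. least_above E (\<Union>\<G>) G" by (rule least_above_exists[OF _ E])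
    qed
    \<comment> \<open>The choice of \<open>g \<G>\<close> is arbitrary, but
      \<open>ua (g \<G>)\<close> is determined by its minimality.\<close>
    then obtain g where least: "\<forall>\<G>\<in>\<M>. least_above E (\<Union>\<G>) (g \<G>)"
      by (rule bchoice[THEN exE])
    have g: "g \<G> \<in> \<F>" "ua (\<Union>\<G>) \<subseteq> ua (g \<G>)" "\<exists>F\<in>\<F>. F \<subseteq> E \<and> ua (g \<G>) \<subseteq> ua F"
      if "\<G> \<in> \<M>" for \<G>
      using least that unfolding least_above_def by blast+
    have g_E: "ua (g \<G>) \<subseteq> E" if "\<G> \<in> \<M>" for \<G>
      using g(3)[OF that] ua_subset_CF_closed[OF E] by (meson order_trans)
    have g_least: "ua (g \<G>) \<subseteq> ua G'"
      if "\<G> \<in> \<M>" "G' \<in> \<F>" "ua (\<Union>\<G>) \<subseteq> ua G'" "F \<in> \<F>" "F \<subseteq> E" "ua G' \<subseteq> ua F" for \<G> G' F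
      using least that unfolding least_above_def by blast
    let ?S = "\<Union>\<G>\<in>\<M>. ua (g \<G>)"
    \<comment> \<open>\<open>g \<H>\<close> is itself a candidate for the smaller family
      \<open>\<G>\<close>. Monotonicity in the index is what makes the sets
      \<open>ua (g \<G>)\<close> directed.\<close>
    have g_mono: "ua (g \<G>) \<subseteq> ua (g \<H>)" if "\<G> \<in> \<M>" "\<H> \<in> \<M>" "\<G> \<subseteq> \<H>" for \<G> \<H>
    proof -
      have "ua (\<Union>\<G>) \<subseteq> ua (g \<H>)"
        using upper_approx_mono[OF Union_mono[OF that(3)]] g(2)[OF that(2)] by (rule order_trans)
      with g(1,3)[OF that(2)] g_least[OF that(1), of "g \<H>"] show ?thesis by blast
    qed
    \<comment> \<open>The empty family, covered by the case \<open>M = {}\<close> of the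
      L-condition, keeps the directed family nonempty; for \<open>\<A> = {}\<close> it gives the
      least element of the ideal.\<close>
    have "{} \<in> \<M>" by (simp add: \<M>_def)
    have S_closed: "CF_closed U R \<F> ?S"
    proof (rule CF_closed_Union_directed(1))
      show "(\<lambda>\<G>. ua (g \<G>)) ` \<M> \<noteq> {}" using \<open>{} \<in> \<M>\<close> by blast
      show "CF_closed U R \<F> D" if "D \<in> (\<lambda>\<G>. ua (g \<G>)) ` \<M>" for D
        using that g(1) CF_closed_ua by blast
      fix D D' assume "D \<in> (\<lambda>\<G>. ua (g \<G>)) ` \<M>" "D' \<in> (\<lambda>\<G>. ua (g \<G>)) ` \<M>"
      then obtain \<G> \<H> where GH: "\<G> \<in> \<M>" "\<H> \<in> \<M>" "D = ua (g \<G>)" "D' = ua (g \<H>)" by blast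
      then have "\<G> \<union> \<H> \<in> \<M>" by (simp add: \<M>_def)
      with GH g_mono[of \<G> "\<G> \<union> \<H>"] g_mono[of \<H> "\<G> \<union> \<H>"]
      show "\<exists>D''\<in>(\<lambda>\<G>. ua (g \<G>)) ` \<M>. D \<subseteq> D'' \<and> D' \<subseteq> D''" by blast
    qed
    have "is_lub ?I ?S \<A>"
      unfolding is_lub_iff[OF A]
    proof (intro conjI ballI impI)
      show "?S \<in> carrier ?I" using S_closed g_E by auto
    next
      fix A assume "A \<in> \<A>"
      have "x \<in> ?S" if x: "x \<in> A" for x
      proof -
        obtain F where F: "F \<in> \<F>" "x \<in> ua F" "F \<subseteq> A"
          using CF_closedD[OF A_closed[OF \<open>A \<in> \<A>\<close>], of "{x}"] x by auto
        then have "{F} \<in> \<M>" using \<open>A \<in> \<A>\<close> by (auto simp: \<M>_def)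
        from g(2)[OF this] F(2) this show ?thesis by auto
      qed
      then show "A \<sqsubseteq>\<^bsub>?I\<^esub> ?S" by auto
    next
      fix B assume "B \<in> carrier ?I" and "\<forall>A\<in>\<A>. A \<sqsubseteq>\<^bsub>?I\<^esub> B"
      then have B: "CF_closed U R \<F> B" "B \<subseteq> E" "\<And>A. A \<in> \<A> \<Longrightarrow> A \<subseteq> B" by auto
      have "ua (g \<G>) \<subseteq> B" if G: "\<G> \<in> \<M>" for \<G>
      proof -
        have "finite (\<Union>\<G>)" "\<Union>\<G> \<subseteq> B"
          using G family_finite_subsets B(3) unfolding \<M>_def by blast+
        from CF_closedD[OF B(1) this]
        obtain F where F: "F \<in> \<F>" "\<Union>\<G> \<subseteq> ua F" "ua F \<subseteq> B" "F \<subseteq> B" by blast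
        \<comment> \<open>Here \<open>F\<close> plays both roles in the minimality of
          \<open>g \<G>\<close>: it is the candidate and also its own bound inside
          \<open>E\<close>.\<close>
        then have "ua (g \<G>) \<subseteq> ua F"
          using g_least[OF G F(1) ua_ua[OF F(2)] F(1)] order_trans[OF F(4) B(2)] by blast
        then show ?thesis using F(3) by (rule order_trans)
      qed
      then show "?S \<sqsubseteq>\<^bsub>?I\<^esub> B" by auto
    qed
    then show "\<exists>S. is_lub ?I S \<A>" ..
  qed
qed

lemma L_domain_CF: "L_domain CF"
  using continuous_domain_CF complete_lattice_CF_ideal by (simp add: L_domain_def)

end

section \<open>Representing an L-domain\<close>

locale continuous_dom = partial_order L for L :: "'a gorder" (structure) +
  assumes continuous: "continuous_domain L"
begin

definition wb_set :: "'a \<Rightarrow> 'a set" where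
  "wb_set x = {y \<in> carrier L. way_below L y x}"

definition wb_rel :: "('a \<times> 'a) set" where
  "wb_rel = {(x, y). x \<in> carrier L \<and> y \<in> carrier L \<and> way_below L x y}"

definition singletons :: "'a set set" where
  "singletons = (\<lambda>x. {x}) ` carrier L"

lemma directed_sup: "directed_in L D \<Longrightarrow> \<exists>s. is_lub L s D"
  using continuous by (auto simp: continuous_domain_def dcpo_def)

lemma wb_set_subset: "wb_set x \<subseteq> carrier L"
  by (auto simp: wb_set_def)

lemma wb_set_carrier: "y \<in> wb_set x \<Longrightarrow> y \<in> carrier L"
  by (simp add: wb_set_def)

lemma directed_wb_set: "x \<in> carrier L \<Longrightarrow> directed_in L (wb_set x)"
  and is_lub_wb_set: "x \<in> carrier L \<Longrightarrow> is_lub L x (wb_set x)"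
  using continuous by (auto simp: continuous_domain_def wb_set_def)

lemma wb_set_le: "y \<in> wb_set x \<Longrightarrow> x \<in> carrier L \<Longrightarrow> y \<sqsubseteq> x"
  using is_lub_wb_set wb_set_subset by (auto simp: is_lub_iff)

lemma le_wb_set_le:
  assumes "x \<sqsubseteq> y" "y \<in> wb_set z" "z \<sqsubseteq> w"
    and "x \<in> carrier L" "z \<in> carrier L" "w \<in> carrier L"
  shows "x \<in> wb_set w"
proof -
  have y: "y \<in> carrier L" "way_below L y z" using assms by (auto simp: wb_set_def)
  have "way_below L x w"
    unfolding way_below_def
  proof (intro allI impI, elim conjE)
    fix D s assume D: "directed_in L D" and s: "is_lub L s D" and "w \<sqsubseteq> s"
    then have "z \<sqsubseteq> s" using assms le_trans[of z w s] by auto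
    then obtain d where "d \<in> D" "y \<sqsubseteq> d" using y D s unfolding way_below_def by blast
    moreover have "d \<in> carrier L" using D \<open>d \<in> D\<close> by (auto simp: directed_in_def)
    ultimately show "\<exists>d\<in>D. x \<sqsubseteq> d" using assms y le_trans[of x y d] by blast
  qed
  then show ?thesis using assms by (simp add: wb_set_def)
qed

text \<open>By continuity \<open>x\<close> is recovered as the supremum of \<open>wb_set x\<close>.
  This makes \<open>wb_set\<close> an order embedding into sets.\<close>

lemma wb_set_subset_iff:
  assumes "x \<in> carrier L" "y \<in> carrier L"
  shows "wb_set x \<subseteq> wb_set y \<longleftrightarrow> x \<sqsubseteq> y"
proof
  assume "wb_set x \<subseteq> wb_set y"
  then have "\<forall>z\<in>wb_set x. z \<sqsubseteq> y" using wb_set_le[OF _ assms(2)] by blast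
  then show "x \<sqsubseteq> y"
    using is_lub_wb_set[OF assms(1)] assms(2) by (simp add: is_lub_iff[OF wb_set_subset])
next
  assume "x \<sqsubseteq> y"
  then show "wb_set x \<subseteq> wb_set y"
    using le_wb_set_le[OF le_refl _ \<open>x \<sqsubseteq> y\<close>] assms wb_set_carrier by blast
qed

lemma directed_finite_upper_bound:
  assumes D: "directed_in L D" and "finite K" "K \<subseteq> carrier L" "\<forall>k\<in>K. \<exists>d\<in>D. k \<sqsubseteq> d"
  shows "\<exists>d\<in>D. \<forall>k\<in>K. k \<sqsubseteq> d"
  using assms(2-)
proof (induction K)
  case empty
  then show ?case using directed_inD(2)[OF D] by auto
next
  case (insert k K)
  then obtain d e where de: "d \<in> D" "\<forall>k\<in>K. k \<sqsubseteq> d" "e \<in> D" "k \<sqsubseteq> e" by auto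
  then obtain c where c: "c \<in> D" "d \<sqsubseteq> c" "e \<sqsubseteq> c" using directed_inD(3)[OF D] by blast
  have carr: "d \<in> carrier L" "e \<in> carrier L" "c \<in> carrier L"
    using directed_inD(1)[OF D] c(1) de(1,3) by auto
  have "k \<sqsubseteq> c" using le_trans[OF de(4) c(3)] carr insert.prems by simp
  moreover have "k' \<sqsubseteq> c" if "k' \<in> K" for k'
    using le_trans[OF _ c(2), of k'] de(2) that carr insert.prems by auto
  ultimately show ?case using c(1) by auto
qed

text \<open>
  Interpolation: the elements lying two way-below steps under \<open>y\<close> form a directed set with
  supremum \<open>y\<close>.
\<close>

lemma wb_set_interpolation:
  assumes y: "y \<in> carrier L" and x: "x \<in> wb_set y"
  shows "\<exists>z\<in>wb_set y. x \<in> wb_set z"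
proof -
  let ?D = "\<Union>(wb_set ` wb_set y)"
  have D: "?D \<subseteq> carrier L" using wb_set_subset by blast
  have dir: "directed_in L ?D"
    unfolding directed_in_def
  proof (intro conjI ballI D)
    obtain z where z: "z \<in> wb_set y" using directed_inD(2)[OF directed_wb_set[OF y]] by blast
    then have "wb_set z \<noteq> {}"
      using directed_inD(2)[OF directed_wb_set[OF wb_set_carrier]] by blast
    then show "?D \<noteq> {}" using z by blast
  next
    fix a b assume "a \<in> ?D" "b \<in> ?D"
    then obtain s t where st: "s \<in> wb_set y" "a \<in> wb_set s" "t \<in> wb_set y" "b \<in> wb_set t" by blast
    then obtain z where z: "z \<in> wb_set y" "s \<sqsubseteq> z" "t \<sqsubseteq> z"
      using directed_inD(3)[OF directed_wb_set[OF y] st(1,3)] by blast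
    have carr: "s \<in> carrier L" "t \<in> carrier L" "z \<in> carrier L"
      using st z by (simp_all add: wb_set_carrier)
    then have "wb_set s \<subseteq> wb_set z" "wb_set t \<subseteq> wb_set z" using z by (simp_all add: wb_set_subset_iff)
    then have "a \<in> wb_set z" "b \<in> wb_set z" using st by auto
    then obtain c where "c \<in> wb_set z" "a \<sqsubseteq> c" "b \<sqsubseteq> c"
      using directed_inD(3)[OF directed_wb_set[OF carr(3)]] by blast
    then show "\<exists>c\<in>?D. a \<sqsubseteq> c \<and> b \<sqsubseteq> c" using z by blast
  qed
  then obtain s where s: "is_lub L s ?D" using directed_sup by blast
  then have sc: "s \<in> carrier L" and s_up: "\<forall>d\<in>?D. d \<sqsubseteq> s" unfolding is_lub_iff[OF D] by auto
  have "z \<sqsubseteq> s" if z: "z \<in> wb_set y" for z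
  proof -
    have zc: "z \<in> carrier L" using z wb_set_subset by blast
    have "\<forall>w\<in>wb_set z. w \<sqsubseteq> s" using s_up z by blast
    then show ?thesis using is_lub_wb_set[OF zc] sc by (simp add: is_lub_iff[OF wb_set_subset])
  qed
  then have "y \<sqsubseteq> s" using is_lub_wb_set[OF y] sc by (simp add: is_lub_iff[OF wb_set_subset])
  then obtain d where d: "d \<in> ?D" "x \<sqsubseteq> d"
    using x dir s unfolding wb_set_def way_below_def by blast
  then obtain z where z: "z \<in> wb_set y" "d \<in> wb_set z" by blast
  then have "z \<in> carrier L" "x \<in> carrier L" using x by (simp_all add: wb_set_carrier)
  then have "x \<in> wb_set z" using le_wb_set_le[OF d(2) z(2) le_refl] by blast
  then show ?thesis using z by blast
qed

text \<open>Each \<open>k\<close> in \<open>K\<close> gets its own interpolant \<open>h k\<close>;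
  the finitely many interpolants have an upper bound in the directed set
  \<open>wb_set y\<close>.\<close>

lemma wb_set_interpolation_finite:
  assumes y: "y \<in> carrier L" and "finite K" and K: "K \<subseteq> wb_set y"
  shows "\<exists>z\<in>wb_set y. K \<subseteq> wb_set z"
proof -
  have "\<forall>k\<in>K. \<exists>z\<in>wb_set y. k \<in> wb_set z" using K wb_set_interpolation[OF y] by blast
  then obtain h where h: "\<And>k. k \<in> K \<Longrightarrow> h k \<in> wb_set y \<and> k \<in> wb_set (h k)" by metis
  have hc: "h ` K \<subseteq> carrier L" using h wb_set_subset by blast
  have "\<forall>w\<in>h ` K. \<exists>z\<in>wb_set y. w \<sqsubseteq> z"
    using h hc le_refl by blast
  with \<open>finite K\<close> hc have "\<exists>z\<in>wb_set y. \<forall>w\<in>h ` K. w \<sqsubseteq> z"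
    by (intro directed_finite_upper_bound[OF directed_wb_set[OF y]]) auto
  then obtain z where z: "z \<in> wb_set y" "\<And>k. k \<in> K \<Longrightarrow> h k \<sqsubseteq> z" by blast
  then have zc: "z \<in> carrier L" using wb_set_subset by blast
  have "k \<in> wb_set z" if "k \<in> K" for k
    using h[OF that] z(2)[OF that] zc wb_set_subset_iff[of "h k" z] wb_set_carrier[of "h k" y] by blast
  then show ?thesis using z by blast
qed

section \<open>The approximation space of singletons under the way-below relation\<close>

lemma upper_approx_wb_rel:
  "A \<subseteq> carrier L \<Longrightarrow> upper_approx (carrier L) wb_rel A = \<Union>(wb_set ` A)"
  by (auto simp: upper_approx_def wb_rel_def wb_set_def)

lemma upper_approx_singleton:
  "x \<in> carrier L \<Longrightarrow> upper_approx (carrier L) wb_rel {x} = wb_set x"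
  by (simp add: upper_approx_wb_rel)

text \<open>Since the approximation of \<open>{x}\<close> is \<open>wb_set x\<close>, the
  interpolation axiom becomes finite interpolation for the way-below relation.\<close>

lemma CF_approximation_space_wb: "CF_approximation_space (carrier L) wb_rel singletons"
  if "carrier L \<noteq> {}"
proof
  show "wb_rel \<subseteq> carrier L \<times> carrier L" by (auto simp: wb_rel_def)
  show "trans wb_rel"
  proof (rule transI)
    fix x y z assume "(x, y) \<in> wb_rel" "(y, z) \<in> wb_rel"
    then have "x \<in> wb_set y" "y \<in> wb_set z" and carr: "y \<in> carrier L" "z \<in> carrier L" "x \<in> carrier L"
      by (auto simp: wb_rel_def wb_set_def)
    then have "x \<in> wb_set z" using wb_set_subset_iff[of y z] wb_set_le[of y z] by blast
    then show "(x, z) \<in> wb_rel" using carr by (auto simp: wb_rel_def wb_set_def)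
  qed
  show "singletons \<noteq> {}" using that by (auto simp: singletons_def)
  show "finite F \<and> F \<subseteq> carrier L" if "F \<in> singletons" for F
    using that by (auto simp: singletons_def)
  fix F K assume "F \<in> singletons" "finite K" "K \<subseteq> upper_approx (carrier L) wb_rel F"
  then obtain x where x: "x \<in> carrier L" "F = {x}" "K \<subseteq> wb_set x"
    by (auto simp: singletons_def upper_approx_singleton)
  then obtain z where "z \<in> wb_set x" "K \<subseteq> wb_set z"
    using wb_set_interpolation_finite \<open>finite K\<close> by blast
  moreover then have "z \<in> carrier L" using wb_set_subset by blast
  ultimately show "\<exists>G\<in>singletons. K \<subseteq> upper_approx (carrier L) wb_rel G \<and>
      G \<subseteq> upper_approx (carrier L) wb_rel F"
    using x by (auto simp: singletons_def upper_approx_singleton)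
qed

text \<open>For singletons, closedness of \<open>E\<close> puts every finite
  \<open>K \<subseteq> E\<close> inside some \<open>wb_set x \<subseteq> E\<close> with
  \<open>x\<close> in \<open>E\<close>. Hence \<open>E\<close> is directed, and its supremum
  \<open>s\<close> satisfies \<open>E = wb_set s\<close>.\<close>

lemma CF_closed_wb_iff:
  "CF_closed (carrier L) wb_rel singletons E \<longleftrightarrow> (\<exists>x\<in>carrier L. E = wb_set x)"
proof
  assume E: "CF_closed (carrier L) wb_rel singletons E"
  then have Ec: "E \<subseteq> carrier L" by (simp add: CF_closed_def)
  have ex: "\<exists>x\<in>E. K \<subseteq> wb_set x \<and> wb_set x \<subseteq> E" if "finite K" "K \<subseteq> E" for K
  proof -
    from CF_closedD[OF E that] obtain F where F: "F \<in> singletons"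
      "K \<subseteq> upper_approx (carrier L) wb_rel F" "upper_approx (carrier L) wb_rel F \<subseteq> E" "F \<subseteq> E"
      by blast
    then obtain x where x: "F = {x}" "x \<in> carrier L" by (auto simp: singletons_def)
    then show ?thesis using F by (auto simp: upper_approx_singleton)
  qed
  have "E \<noteq> {}" using ex[of "{}"] by blast
  moreover have "\<exists>z\<in>E. x \<sqsubseteq> z \<and> y \<sqsubseteq> z" if xy: "x \<in> E" "y \<in> E" for x y
  proof -
    obtain z where z: "z \<in> E" "x \<in> wb_set z" "y \<in> wb_set z"
      using ex[of "{x, y}"] xy by auto
    then have "z \<in> carrier L" using Ec by blast
    then have "x \<sqsubseteq> z" "y \<sqsubseteq> z" using z wb_set_le by simp_all
    then show ?thesis using z(1) by blast
  qed
  ultimately have dir: "directed_in L E" using Ec by (simp add: directed_in_def)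
  then obtain s where s: "is_lub L s E" using directed_sup by blast
  then have sc: "s \<in> carrier L" and up: "\<And>x. x \<in> E \<Longrightarrow> x \<sqsubseteq> s" by (auto simp: is_lub_iff[OF Ec])
  have "E = wb_set s"
  proof (intro equalityI subsetI)
    fix e assume "e \<in> E"
    then obtain x where x: "x \<in> E" "e \<in> wb_set x" using ex[of "{e}"] by auto
    then have "wb_set x \<subseteq> wb_set s" using up sc subsetD[OF Ec] by (simp add: wb_set_subset_iff)
    then show "e \<in> wb_set s" using x(2) by (rule subsetD)
  next
    fix y assume y: "y \<in> wb_set s"
    then have yc: "y \<in> carrier L" using wb_set_subset by blast
    obtain e where e: "e \<in> E" "y \<sqsubseteq> e"
      using y dir s le_refl[OF sc] unfolding wb_set_def way_below_def by blast
    \<comment> \<open>To pass from \<open>e\<close> down to \<open>y\<close> within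
      \<open>E\<close>, closedness places \<open>e\<close> in a set \<open>wb_set x\<close> inside
      \<open>E\<close>, and such a set is downward closed.\<close>
    then obtain x where x: "x \<in> E" "e \<in> wb_set x" "wb_set x \<subseteq> E" using ex[of "{e}"] by auto
    then have "x \<in> carrier L" using Ec by blast
    then have "y \<in> wb_set x" using le_wb_set_le[OF e(2) x(2) le_refl] yc by blast
    then show "y \<in> E" using x(3) by blast
  qed
  then show "\<exists>x\<in>carrier L. E = wb_set x" using sc by blast
next
  assume "\<exists>x\<in>carrier L. E = wb_set x"
  then obtain x where x: "x \<in> carrier L" "E = wb_set x" by blast
  then interpret CF_approximation_space "carrier L" wb_rel singletons
    by (intro CF_approximation_space_wb) blast
  show "CF_closed (carrier L) wb_rel singletons E"
    using CF_closed_ua[of "{x}"] x by (auto simp: singletons_def upper_approx_singleton)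
qed

lemma order_isomorphic_CF_closed_wb:
  "order_isomorphic L (CF_closed_sets (carrier L) wb_rel singletons)"
  unfolding order_isomorphic_def
proof (intro exI conjI)
  have "inj_on wb_set (carrier L)"
    using wb_set_subset_iff le_antisym by (intro inj_onI) (metis order_refl)
  then show "bij_betw wb_set (carrier L) (carrier (CF_closed_sets (carrier L) wb_rel singletons))"
    by (auto simp: bij_betw_def CF_closed_wb_iff)
  show "order_emb L (CF_closed_sets (carrier L) wb_rel singletons) wb_set"
    using weak_partial_order_axioms partial_order.axioms(1)[OF partial_order_CF_closed_sets]
    by (simp add: order_emb_def wb_set_subset_iff)
qed

text \<open>Through \<open>M_le\<close> and \<open>le\<close>, a solution \<open>{g}\<close> of the
  L-condition for \<open>F = {x}\<close> is a least element among the upper bounds of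
  \<open>M\<close> below \<open>x\<close>, that is, a supremum of \<open>M\<close> in the ideal of
  \<open>x\<close>.\<close>

lemma L_approximation_space_wb:
  assumes "carrier L \<noteq> {}"
    and ideals: "\<And>x. x \<in> carrier L \<Longrightarrow> complete_lattice (L\<lparr>carrier := {y \<in> carrier L. y \<sqsubseteq> x}\<rparr>)"
  shows "L_approximation_space (carrier L) wb_rel singletons"
proof -
  interpret CF_approximation_space "carrier L" wb_rel singletons
    by (rule CF_approximation_space_wb) fact
  show ?thesis
  proof
    fix M F assume "F \<in> singletons" and "M \<subseteq> upper_approx (carrier L) wb_rel F"
    then obtain x where x: "x \<in> carrier L" "F = {x}" "M \<subseteq> wb_set x"
      by (auto simp: singletons_def upper_approx_singleton)
    let ?I = "L\<lparr>carrier := {y \<in> carrier L. y \<sqsubseteq> x}\<rparr>"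
    interpret I: complete_lattice ?I by (rule ideals) fact
    have MI: "M \<subseteq> carrier ?I" using x wb_set_le wb_set_carrier by auto
    then obtain g where "is_lub ?I g M" using I.sup_exists by blast
    then have g: "g \<in> carrier L" "g \<sqsubseteq> x" "\<And>m. m \<in> M \<Longrightarrow> m \<sqsubseteq> g"
      and least: "\<And>u. u \<in> carrier L \<Longrightarrow> u \<sqsubseteq> x \<Longrightarrow> \<forall>m\<in>M. m \<sqsubseteq> u \<Longrightarrow> g \<sqsubseteq> u"
      unfolding is_lub_iff[OF MI] by auto
    have Mc: "M \<subseteq> carrier L" using MI by auto
    have M_le: "ua M \<subseteq> ua {u} \<longleftrightarrow> (\<forall>m\<in>M. m \<sqsubseteq> u)" if "u \<in> carrier L" for u
      using that subsetD[OF Mc]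
      by (simp add: upper_approx_wb_rel[OF Mc] upper_approx_singleton UN_subset_iff wb_set_subset_iff)
    have le: "ua {u} \<subseteq> ua {v} \<longleftrightarrow> u \<sqsubseteq> v" if "u \<in> carrier L" "v \<in> carrier L" for u v
      using that by (simp add: upper_approx_singleton wb_set_subset_iff)
    show "\<exists>G\<in>singletons. ua M \<subseteq> ua G \<and> ua G \<subseteq> ua F \<and>
        (\<forall>G'\<in>singletons. ua M \<subseteq> ua G' \<and> ua G' \<subseteq> ua F \<longrightarrow> ua G \<subseteq> ua G')"
    proof (rule bexI[of _ "{g}"])
      show "{g} \<in> singletons" using g by (simp add: singletons_def)
      show "ua M \<subseteq> ua {g} \<and> ua {g} \<subseteq> ua F \<and>
          (\<forall>G'\<in>singletons. ua M \<subseteq> ua G' \<and> ua G' \<subseteq> ua F \<longrightarrow> ua {g} \<subseteq> ua G')"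
        using g x(1) least by (auto simp: singletons_def x(2) M_le le)
    qed
  qed
qed

end

section \<open>The representation of L-domains, with the converse for universes of arbitrary
  type\<close>

theorem theorem5p4:
  fixes L :: "'a gorder"
  assumes "partial_order L" and "carrier L \<noteq> {}"
  shows "(L_domain L \<longleftrightarrow>
            (\<exists>(U :: 'a set) R \<F>. L_approximation_space U R \<F> \<and>
               order_isomorphic L (CF_closed_sets U R \<F>))) \<and>
         ((\<exists>(U :: 'u set) R \<F>. L_approximation_space U R \<F> \<and>
               order_isomorphic L (CF_closed_sets U R \<F>)) \<longrightarrow> L_domain L)"
proof (intro conjI iffI impI)
  assume L: "L_domain L"
  interpret partial_order L by fact
  interpret continuous_dom L
    by unfold_locales (use L in \<open>simp add: L_domain_def\<close>)
  have "L_approximation_space (carrier L) wb_rel singletons"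
    using assms(2) L by (intro L_approximation_space_wb) (auto simp: L_domain_def)
  then show "\<exists>(U :: 'a set) R \<F>. L_approximation_space U R \<F> \<and>
      order_isomorphic L (CF_closed_sets U R \<F>)"
    using order_isomorphic_CF_closed_wb by blast
next
  assume "\<exists>(U :: 'a set) R \<F>. L_approximation_space U R \<F> \<and>
      order_isomorphic L (CF_closed_sets U R \<F>)"
  then show "L_domain L"
    using L_approximation_space.L_domain_CF L_domain_order_isomorphic[OF assms(1)] by blast
next
  assume "\<exists>(U :: 'u set) R \<F>. L_approximation_space U R \<F> \<and>
      order_isomorphic L (CF_closed_sets U R \<F>)"
  then show "L_domain L"
    using L_approximation_space.L_domain_CF L_domain_order_isomorphic[OF assms(1)] by blast
qed

end
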